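(* Let $\mathcal{C}=\{x\in\mathbb{R}^{n_x}\mid c(x)\ge 0\}$ with $c:\mathbb{R}^{n_x}\to\mathbb{R}^{n_c}$ continuously differentiable, let $f:\mathbb{R}^{n_x}\times\mathbb{R}^{n_u}\to\mathbb{R}^{n_x}$ be differentiable, let $u:[0,T]\to\mathbb{R}^{n_u}$ be a given control function, and let $\mathcal{E}\subseteq\mathbb{R}^{n_x}$ be the linear subspace spanned by the columns of a matrix $E\in\mathbb{R}^{n_x\times n'}$ ($n'\le n_x$) whose columns are orthonormal. Let $x:[0,T]\to\mathbb{R}^{n_x}$ be absolutely continuous with $x(0)\in\mathcal{C}$. Assume that the Linear Independence Constraint Qualification holds along $x$, i.e., for every $t$ with $x(t)\in\mathcal{C}$ the gradients $\nabla c_i(x(t))$, $i\in\mathcal{A}(x(t))$, are linearly independent, and that for all such times $\mathcal{T}_{\mathcal{C}}(x(t))\cap\big(f(x(t),u(t))+\mathcal{E}\big)\neq\emptyset$. Then $x$ is a solution of the extended projected dynamical system $$\dot{x}=\mathrm{P}_{\mathcal{T}_{\mathcal{C}}(x),\mathcal{E}}\big(f(x,u)\big),\qquad x(0)\in\mathcal{C},$$ if and only if $x$ is a solution of the dynamic complementarity system $$\dot{x}=f(x,u)+EE^\top\nabla_x c(x)\lambda,\qquad 0\le\lambda\perp c(x)\ge 0 .$$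
   Context: Inequalities between vectors are componentwise. $\nabla c(x)\in\mathbb{R}^{n_x\times n_c}$ is the matrix whose $i$-th column is the gradient $\nabla c_i(x)$. The notation $0\le a\perp b\ge 0$ means $a\ge0$, $b\ge 0$ and $a^\top b=0$. The active set is $\mathcal{A}(x)=\{i\in\{1,\dots,n_c\}\mid c_i(x)=0\}$. The tangent cone to a closed set $\mathcal{C}$ at $x\in\mathcal{C}$ is $\mathcal{T}_{\mathcal{C}}(x)=\{d\mid \exists\, x_i\in\mathcal{C},\ t_i>0,\ x_i\to x,\ t_i\to 0,\ d=\lim_{i\to\infty}(x_i-x)/t_i\}$; it is the empty set for $x\notin\mathcal{C}$. For a closed convex set $\mathcal{K}$, a linear subspace $\mathcal{E}$ and a vector $v$ with $\mathcal{K}\cap(v+\mathcal{E})\ne\emptyset$, the extended projection is $$\mathrm{P}_{\mathcal{K},\mathcal{E}}(v)=\arg\min_{w}\ \tfrac12\|w-v\|_2^2\quad\text{s.t.}\quad w\in\mathcal{K},\ w-v\in\mathcal{E}.$$ A solution of the extended projected dynamical system is an absolutely continuous function $x:[0,T]\to\mathbb{R}^{n_x}$ with $x(t)\in\mathcal{C}$ for all $t$ that satisfies the differential equation for almost every $t$. A solution of the dynamic complementarity system is an absolutely continuous function $x:[0,T]\to\mathbb{R}^{n_x}$ for which there is a function $\lambda:[0,T]\to\mathbb{R}^{n_c}$ such that both relations hold for almost every $t\in[0,T]$. *)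

theory Defs
  imports "HOL-Analysis.Analysis"
begin

definition continuously_differentiable ::
    "('a::real_normed_vector \<Rightarrow> 'b::real_normed_vector) \<Rightarrow> bool" where
  "continuously_differentiable g \<longleftrightarrow>
     (\<exists>g'. (\<forall>x. (g has_derivative blinfun_apply (g' x)) (at x)) \<and> continuous_on UNIV g')"

definition gradient :: "(real^'n \<Rightarrow> real) \<Rightarrow> real^'n \<Rightarrow> real^'n" where
  "gradient g x = (THE D. GDERIV g x :> D)"

definition gradient_matrix :: "(real^'n \<Rightarrow> real^'c) \<Rightarrow> real^'n \<Rightarrow> real^'c^'n" where
  "gradient_matrix c x = (\<chi> j i. gradient (\<lambda>y. c y $ i) x $ j)"

definition active_set :: "(real^'n \<Rightarrow> real^'c) \<Rightarrow> real^'n \<Rightarrow> 'c set" where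
  "active_set c x = {i. c x $ i = 0}"

text \<open>Linear independence is that of the indexed family of active gradients: two active
  constraints with the same gradient violate the condition, hence the injectivity requirement.\<close>

definition LICQ :: "(real^'n \<Rightarrow> real^'c) \<Rightarrow> real^'n \<Rightarrow> bool" where
  "LICQ c x \<longleftrightarrow>
     inj_on (\<lambda>i. gradient (\<lambda>y. c y $ i) x) (active_set c x) \<and>
     independent ((\<lambda>i. gradient (\<lambda>y. c y $ i) x) ` active_set c x)"

text \<open>The order on vectors is the componentwise one.\<close>

definition feasible_set :: "(real^'n \<Rightarrow> real^'c) \<Rightarrow> (real^'n) set" where
  "feasible_set c = {x. 0 \<le> c x}"

definition complementary :: "real^'c \<Rightarrow> real^'c \<Rightarrow> bool" where
  "complementary a b \<longleftrightarrow> 0 \<le> a \<and> 0 \<le> b \<and> a \<bullet> b = 0"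

definition tangent_cone :: "'a::real_normed_vector set \<Rightarrow> 'a \<Rightarrow> 'a set" where
  "tangent_cone C x =
     {d. x \<in> C \<and>
         (\<exists>X \<tau>. (\<forall>i::nat. X i \<in> C) \<and> (\<forall>i. 0 < \<tau> i) \<and> X \<longlonglongrightarrow> x \<and> \<tau> \<longlonglongrightarrow> 0 \<and>
                (\<lambda>i. (X i - x) /\<^sub>R \<tau> i) \<longlonglongrightarrow> d)}"

text \<open>Meaningful when \<open>K\<close> is closed and convex and \<open>S\<close> is a linear subspace such that \<open>K\<close> meets
  the translate of \<open>S\<close> by \<open>v\<close>: the minimizer then exists and is unique. Otherwise the value is
  unspecified.\<close>

definition extended_projection ::
    "'a::real_normed_vector set \<Rightarrow> 'a set \<Rightarrow> 'a \<Rightarrow> 'a" where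
  "extended_projection K S v =
     arg_min_on (\<lambda>w. 1/2 * (norm (w - v))\<^sup>2) {w. w \<in> K \<and> w - v \<in> S}"

text \<open>A pair \<open>(a, b)\<close> in \<open>D\<close> stands for the interval with these endpoints; the intervals do not
  overlap, but may share endpoints.\<close>

definition absolutely_continuous_fun_on ::
    "real set \<Rightarrow> (real \<Rightarrow> 'a::real_normed_vector) \<Rightarrow> bool" where
  "absolutely_continuous_fun_on I x \<longleftrightarrow>
     (\<forall>\<epsilon>>0. \<exists>\<delta>>0. \<forall>D.
        finite D \<and> (\<forall>(a, b)\<in>D. a < b \<and> {a..b} \<subseteq> I) \<and>
        pairwise (\<lambda>(a, b) (a', b'). {a<..<b} \<inter> {a'<..<b'} = {}) D \<and>
        (\<Sum>(a, b)\<in>D. b - a) < \<delta>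
        \<longrightarrow> (\<Sum>(a, b)\<in>D. norm (x b - x a)) < \<epsilon>)"

definition orthonormal_columns :: "real^'k^'n \<Rightarrow> bool" where
  "orthonormal_columns E \<longleftrightarrow>
     (\<forall>i j. column i E \<bullet> column j E = (if i = j then 1 else 0))"

text \<open>The one-sided derivatives at the endpoints of the time interval are immaterial: the
  equations are only required almost everywhere. Values of \<open>x\<close>, \<open>u\<close> and the multiplier outside
  the interval play no role.\<close>

definition ePDS_solution ::
    "real \<Rightarrow> (real^'n) set \<Rightarrow> (real^'n) set \<Rightarrow> ((real^'n) \<times> (real^'m) \<Rightarrow> real^'n) \<Rightarrow>
     (real \<Rightarrow> real^'m) \<Rightarrow> (real \<Rightarrow> real^'n) \<Rightarrow> bool" where
  "ePDS_solution T C S f u x \<longleftrightarrow>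
     absolutely_continuous_fun_on {0..T} x \<and> x 0 \<in> C \<and> (\<forall>t\<in>{0..T}. x t \<in> C) \<and>
     (AE t in lebesgue_on {0..T}.
        (x has_vector_derivative extended_projection (tangent_cone C (x t)) S (f (x t, u t)))
          (at t within {0..T}))"

definition DCS_solution ::
    "real \<Rightarrow> (real^'n \<Rightarrow> real^'c) \<Rightarrow> real^'k^'n \<Rightarrow> ((real^'n) \<times> (real^'m) \<Rightarrow> real^'n) \<Rightarrow>
     (real \<Rightarrow> real^'m) \<Rightarrow> (real \<Rightarrow> real^'n) \<Rightarrow> bool" where
  "DCS_solution T c E f u x \<longleftrightarrow>
     absolutely_continuous_fun_on {0..T} x \<and>
     (\<exists>l::real \<Rightarrow> real^'c. AE t in lebesgue_on {0..T}.
        (x has_vector_derivative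
           f (x t, u t) + (E ** transpose E ** gradient_matrix c (x t)) *v l t)
          (at t within {0..T}) \<and>
        complementary (l t) (c (x t)))"

end

theory Submission
  imports Defs
begin

text \<open>
  Fix a time at which the state \<open>x\<close> is feasible. The argument compares the velocity
  prescribed by the projection with the one prescribed by the complementarity system through
  the optimality conditions of the projection.

  First, the tangent cone is polyhedral (\<open>tangent_cone_LICQ\<close>): it consists of the directions
  along which no active constraint decreases to first order. Linear independence of the active
  gradients provides a direction \<open>d\<^sub>0\<close> along which every active constraint strictly increases;
  a linearized feasible direction \<open>d\<close> is then the limit of the directions \<open>d + \<epsilon> d\<^sub>0\<close>, along
  which one can move inside the feasible set. No implicit function theorem is required.

  Secondly, since \<open>E\<close> has orthonormal columns, \<open>E E\<^sup>T\<close> is the orthogonal projector onto their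
  span, and the Farkas lemma shows (\<open>closest_point_polyhedral_section_iff\<close>) that \<open>w\<close> is the
  extended projection of \<open>v\<close> if and only if \<open>w\<close> lies in the tangent cone and
  \<open>w = v + E E\<^sup>T \<nabla>c(x) \<lambda>\<close> for some \<open>\<lambda> \<ge> 0\<close> that is complementary to \<open>c(x)\<close> and satisfies
  \<open>\<lambda>\<^sub>i (\<nabla>c\<^sub>i(x) \<bullet> w) = 0\<close> for all \<open>i\<close>. The projection problem has a
  nonempty admissible set by assumption, and it is convex with linear constraints, so
  these conditions are necessary and sufficient even though the projected active gradients may be
  linearly dependent.

  The projected system therefore implies the complementarity system, the multiplier being
  chosen separately at every time. The converse lacks two conditions: that the velocity lies in
  the tangent cone and that the multiplier annihilates \<open>\<nabla>c\<^sub>i(x) \<bullet> w\<close>. Both hold at interior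
  times of differentiability, because the trajectory is feasible at all times: if constraint
  \<open>i\<close> is active at time \<open>t\<close>, then \<open>s \<mapsto> c\<^sub>i(x(s))\<close> has a minimum at \<open>t\<close>, and its derivative
  \<open>\<nabla>c\<^sub>i(x) \<bullet> w\<close> vanishes (\<open>feasible_velocity_orthogonal\<close>). Feasibility at all times follows
  from feasibility at almost all times by continuity.
\<close>


section \<open>Gradients\<close>

lemma has_derivative_gradient:
  fixes g :: "real^'n \<Rightarrow> real"
  assumes "g differentiable (at x)"
  shows "(g has_derivative (\<lambda>h. gradient g x \<bullet> h)) (at x)"
proof -
  obtain g' where g': "(g has_derivative g') (at x)"
    using assms by (auto simp: differentiable_def)
  interpret g': bounded_linear g' by (rule has_derivative_bounded_linear[OF g'])
  define D where "D = adjoint g' 1"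
  have "g' h = h \<bullet> D" for h
    using adjoint_works[OF g'.linear_axioms, of h 1] by (simp add: D_def)
  then have D: "(g has_derivative (\<lambda>h. h \<bullet> D)) (at x)"
    using g' by presburger
  have "gradient g x = D"
    unfolding gradient_def gderiv_def
  proof (rule the_equality)
    show "(g has_derivative (\<lambda>h. h \<bullet> D)) (at x)" by (rule D)
    fix D' assume "(g has_derivative (\<lambda>h. h \<bullet> D')) (at x)"
    from fun_cong[OF has_derivative_unique[OF this D]] have "\<forall>h. h \<bullet> D' = h \<bullet> D" by blast
    then show "D' = D" by (simp only: vector_eq_ldot)
  qed
  with D show ?thesis by (simp add: inner_commute)
qed

lemma continuously_differentiable_component:
  fixes c :: "real^'n \<Rightarrow> real^'c"
  assumes "continuously_differentiable c"
  shows "(\<lambda>y. c y $ i) differentiable (at x)"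
proof -
  obtain c' where "(c has_derivative blinfun_apply (c' x)) (at x)"
    using assms by (auto simp: continuously_differentiable_def)
  then show ?thesis
    unfolding differentiable_def
    by (blast intro: bounded_linear.has_derivative[OF bounded_linear_vec_nth])
qed

text \<open>The \<open>i\<close>-th column \<open>\<nabla>c\<^sub>i(x)\<close> of the gradient matrix.\<close>

abbreviation cgrad :: "(real^'n \<Rightarrow> real^'c) \<Rightarrow> real^'n \<Rightarrow> 'c \<Rightarrow> real^'n" where
  "cgrad c x i \<equiv> gradient (\<lambda>y. c y $ i) x"

lemmas has_derivative_cgrad =
  has_derivative_gradient[OF continuously_differentiable_component]

lemma gradient_matrix_mult:
  "gradient_matrix c x *v l = (\<Sum>i\<in>UNIV. l $ i *\<^sub>R cgrad c x i)"
  by (simp add: gradient_matrix_def matrix_vector_mult_def vec_eq_iff mult.commute)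


section \<open>The tangent cone under the constraint qualification\<close>

text \<open>Applied to the active gradients, this gives a direction along which all active constraints
  strictly increase.\<close>

lemma independent_imp_common_inner_product:
  fixes B :: "'a::euclidean_space set"
  assumes "independent B"
  shows "\<exists>d. \<forall>b\<in>B. b \<bullet> d = 1"
proof -
  obtain g :: "'a \<Rightarrow> real" where g: "linear g" "\<forall>b\<in>B. g b = 1"
    using linear_independent_extend[OF assms, of "\<lambda>_. 1"] by auto
  have "g b = b \<bullet> adjoint g 1" for b
    using adjoint_works[OF g(1), of b 1] by simp
  with g(2) show ?thesis by metis
qed

text \<open>No constraint qualification is needed for this inclusion.\<close>

lemma tangent_cone_imp_linearized:
  assumes c: "continuously_differentiable c"
    and d: "d \<in> tangent_cone (feasible_set c) x"
    and i: "i \<in> active_set c x"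
  shows "0 \<le> cgrad c x i \<bullet> d"
proof (rule field_le_epsilon)
  fix e' :: real assume "0 < e'"
  \<comment> \<open>First-order accuracy \<open>e\<close> in the difference quotients costs at most \<open>e * norm d \<le> e'\<close> in the
    limit.\<close>
  define e where "e = e' / (1 + norm d)"
  have nd: "0 < 1 + norm d" using norm_ge_zero[of d] by linarith
  have e: "0 < e" using \<open>0 < e'\<close> nd by (simp add: e_def)
  have "e * norm d \<le> e * (1 + norm d)" using e by simp
  also have "\<dots> = e'" using nd by (simp add: e_def)
  finally have ee': "e * norm d \<le> e'" .
  obtain X \<tau> where X: "\<And>n::nat. X n \<in> feasible_set c" "X \<longlonglongrightarrow> x"
    and \<tau>: "\<And>n. 0 < \<tau> n" and lim: "(\<lambda>n. (X n - x) /\<^sub>R \<tau> n) \<longlonglongrightarrow> d"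
    using d by (auto simp: tangent_cone_def)
  obtain r where "r > 0" and
    r: "\<And>y. norm (y - x) < r \<Longrightarrow>
          norm (c y $ i - c x $ i - cgrad c x i \<bullet> (y - x)) \<le> e * norm (y - x)"
    using has_derivative_cgrad[OF c, of i x] e unfolding has_derivative_at_alt by blast
  have "\<forall>\<^sub>F n in sequentially. norm (X n - x) < r"
    using X(2) \<open>r > 0\<close> by (auto simp: tendsto_iff dist_norm)
  then have ev: "\<forall>\<^sub>F n in sequentially.
      0 \<le> cgrad c x i \<bullet> ((X n - x) /\<^sub>R \<tau> n) + e * norm ((X n - x) /\<^sub>R \<tau> n)"
  proof eventually_elim
    case (elim n)
    have "0 \<le> c (X n) $ i" "c x $ i = 0"
      using X(1)[of n] i by (auto simp: feasible_set_def less_eq_vec_def active_set_def)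
    with r[OF elim] have "0 \<le> cgrad c x i \<bullet> (X n - x) + e * norm (X n - x)"
      by (simp add: abs_le_iff)
    then have "0 \<le> inverse (\<tau> n) * (cgrad c x i \<bullet> (X n - x) + e * norm (X n - x))"
      using \<tau>[of n] by simp
    also have "\<dots> = cgrad c x i \<bullet> ((X n - x) /\<^sub>R \<tau> n) + e * norm ((X n - x) /\<^sub>R \<tau> n)"
      using \<tau>[of n] by (simp only: inner_scaleR_right norm_scaleR) (simp add: distrib_left)
    finally show ?case .
  qed
  have "(\<lambda>n. cgrad c x i \<bullet> ((X n - x) /\<^sub>R \<tau> n) + e * norm ((X n - x) /\<^sub>R \<tau> n))
          \<longlonglongrightarrow> cgrad c x i \<bullet> d + e * norm d"
    by (intro tendsto_intros lim)
  from tendsto_lowerbound[OF this ev] have "0 \<le> cgrad c x i \<bullet> d + e * norm d" by simp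
  with ee' show "0 \<le> cgrad c x i \<bullet> d + e'" by linarith
qed

lemma eventually_feasible_along_ascent:
  assumes c: "continuously_differentiable c" and x: "x \<in> feasible_set c"
    and q: "\<And>i. i \<in> active_set c x \<Longrightarrow> 0 < cgrad c x i \<bullet> q"
  shows "\<forall>\<^sub>F s in at_right 0. x + s *\<^sub>R q \<in> feasible_set c"
proof -
  have "\<forall>\<^sub>F s in at_right 0. 0 \<le> c (x + s *\<^sub>R q) $ i" for i
  proof -
    define \<phi> where "\<phi> s = c (x + s *\<^sub>R q) $ i" for s
    have "((\<lambda>s. x + s *\<^sub>R q) has_derivative (\<lambda>h. h *\<^sub>R q)) (at 0)"
      by (auto intro!: derivative_eq_intros)
    from has_derivative_compose[OF this, of "\<lambda>y. c y $ i" "\<lambda>h. cgrad c x i \<bullet> h"]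
    have "(\<phi> has_derivative (\<lambda>h. cgrad c x i \<bullet> (h *\<^sub>R q))) (at 0)"
      using has_derivative_cgrad[OF c] by (simp add: \<phi>_def[abs_def])
    then have D: "(\<phi> has_real_derivative (cgrad c x i \<bullet> q)) (at 0)"
      by (simp add: has_field_derivative_def mult.commute[of _ "cgrad c x i \<bullet> q"])
    have "0 \<le> \<phi> 0" using x by (simp add: feasible_set_def less_eq_vec_def \<phi>_def)
    then consider "i \<in> active_set c x" "\<phi> 0 = 0" | "0 < \<phi> 0"
      by (force simp: active_set_def \<phi>_def)
    then have "\<forall>\<^sub>F s in at_right 0. 0 \<le> \<phi> s"
    proof cases
      case 1
      from has_real_derivative_pos_inc_right[OF D q[OF 1(1)]]
      obtain r where "r > 0" "\<And>h. 0 < h \<Longrightarrow> h < r \<Longrightarrow> \<phi> 0 < \<phi> h" by auto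
      with 1(2) show ?thesis
        by (auto simp: eventually_at_right_field intro!: exI[of _ r] less_imp_le)
    next
      case 2
      have "(\<phi> \<longlongrightarrow> \<phi> 0) (at_right 0)"
        using DERIV_isCont[OF D] by (simp add: isCont_def filterlim_at_split)
      from order_tendstoD(1)[OF this 2] show ?thesis
        by (rule eventually_mono) simp
    qed
    then show ?thesis by (simp add: \<phi>_def)
  qed
  then show ?thesis
    by (simp add: feasible_set_def less_eq_vec_def eventually_all_finite)
qed

lemma tangent_cone_LICQ:
  assumes c: "continuously_differentiable c" and x: "x \<in> feasible_set c" and L: "LICQ c x"
  shows "tangent_cone (feasible_set c) x = {d. \<forall>i\<in>active_set c x. 0 \<le> cgrad c x i \<bullet> d}"
proof (intro equalityI subsetI CollectI ballI)
  fix d i assume "d \<in> tangent_cone (feasible_set c) x" "i \<in> active_set c x"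
  then show "0 \<le> cgrad c x i \<bullet> d" by (rule tangent_cone_imp_linearized[OF c])
next
  fix d assume "d \<in> {d. \<forall>i\<in>active_set c x. 0 \<le> cgrad c x i \<bullet> d}"
  then have d: "\<And>i. i \<in> active_set c x \<Longrightarrow> 0 \<le> cgrad c x i \<bullet> d" by auto
  obtain d0 where d0: "\<And>i. i \<in> active_set c x \<Longrightarrow> cgrad c x i \<bullet> d0 = 1"
    using independent_imp_common_inner_product L unfolding LICQ_def by blast
  \<comment> \<open>Along the perturbed directions \<open>q n\<close> every active constraint strictly increases, so a step
    of some length \<open>s n < \<epsilon> n\<close> stays feasible.\<close>
  define \<epsilon> where "\<epsilon> n = inverse (real (Suc n))" for n
  define q where "q n = d + \<epsilon> n *\<^sub>R d0" for n
  have \<epsilon>: "0 < \<epsilon> n" for n by (simp add: \<epsilon>_def)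
  have \<epsilon>_lim: "\<epsilon> \<longlonglongrightarrow> 0"
    unfolding \<epsilon>_def[abs_def] by (rule LIMSEQ_inverse_real_of_nat)
  have q_lim: "q \<longlonglongrightarrow> d"
  proof -
    have "(\<lambda>n. d + \<epsilon> n *\<^sub>R d0) \<longlonglongrightarrow> d + 0 *\<^sub>R d0"
      by (intro tendsto_intros \<epsilon>_lim)
    then show ?thesis by (simp add: q_def[abs_def])
  qed
  have "\<exists>s. 0 < s \<and> s < \<epsilon> n \<and> x + s *\<^sub>R q n \<in> feasible_set c" for n
  proof -
    have "\<forall>\<^sub>F s in at_right 0. x + s *\<^sub>R q n \<in> feasible_set c"
      using d d0 \<epsilon>[of n]
      by (intro eventually_feasible_along_ascent c x) (simp add: q_def inner_add_right add_nonneg_pos)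
    moreover have "\<forall>\<^sub>F s in at_right 0. 0 < s \<and> s < \<epsilon> n"
      using \<epsilon>[of n] by (auto simp: eventually_at_right_field)
    ultimately have "\<forall>\<^sub>F s in at_right 0. 0 < s \<and> s < \<epsilon> n \<and> x + s *\<^sub>R q n \<in> feasible_set c"
      by eventually_elim simp
    then show ?thesis
      by (rule eventually_happens'[rotated]) simp
  qed
  then obtain s where s: "\<And>n. 0 < s n" "\<And>n. s n < \<epsilon> n"
      "\<And>n. x + s n *\<^sub>R q n \<in> feasible_set c"
    by metis
  have s_lim: "s \<longlonglongrightarrow> 0"
    by (rule tendsto_sandwich[OF _ _ tendsto_const \<epsilon>_lim]) (auto intro: always_eventually less_imp_le s)
  have "(\<lambda>n. x + s n *\<^sub>R q n) \<longlonglongrightarrow> x + 0 *\<^sub>R d"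
    by (intro tendsto_intros s_lim q_lim)
  moreover have "(\<lambda>n. (x + s n *\<^sub>R q n - x) /\<^sub>R s n) = q"
    using s(1) by (auto simp: fun_eq_iff less_imp_neq[symmetric])
  ultimately show "d \<in> tangent_cone (feasible_set c) x"
    using x s s_lim q_lim unfolding tangent_cone_def
    by (auto intro!: exI[of _ "\<lambda>n. x + s n *\<^sub>R q n"] exI[of _ s])
qed


section \<open>Multipliers for projections onto polyhedral cones\<close>

text \<open>A vector outside the cone generated by finitely many vectors is strictly separated from it,
  as this cone is closed.\<close>

lemma Farkas:
  fixes a :: "'i \<Rightarrow> 'a::euclidean_space"
  assumes I: "finite I"
    and b: "\<And>d. (\<And>i. i \<in> I \<Longrightarrow> 0 \<le> a i \<bullet> d) \<Longrightarrow> 0 \<le> b \<bullet> d"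
  shows "\<exists>l. (\<forall>i\<in>I. 0 \<le> l i) \<and> b = (\<Sum>i\<in>I. l i *\<^sub>R a i)"
proof -
  let ?L = "{y. \<exists>l. (\<forall>i\<in>I. 0 \<le> l i) \<and> y = (\<Sum>i\<in>I. l i *\<^sub>R a i)}"
  define K where "K = convex_cone hull (a ` I)"
  have K: "closed K" "convex K"
    using I by (simp_all add: K_def closed_convex_cone_hull convex_convex_cone_hull)
  have "b \<in> K"
  proof (rule ccontr)
    assume "b \<notin> K"
    from separating_hyperplane_closed_point[OF K(2,1) this]
    obtain d \<beta> where d: "d \<bullet> b < \<beta>" "\<And>k. k \<in> K \<Longrightarrow> \<beta> < d \<bullet> k" by blast
    have "0 \<in> K" by (simp add: K_def convex_cone_hull_contains_0)
    with d have "d \<bullet> b < 0" by fastforce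
    moreover have "0 \<le> a i \<bullet> d" if i: "i \<in> I" for i
    proof (rule ccontr)
      assume neg: "\<not> 0 \<le> a i \<bullet> d"
      \<comment> \<open>The cone contains all nonnegative multiples of \<open>a i\<close>; this one lies on the wrong
        side of the hyperplane.\<close>
      define t where "t = \<bar>\<beta>\<bar> / - (a i \<bullet> d)"
      have "0 \<le> t" using neg by (simp add: t_def divide_nonneg_neg)
      then have "t *\<^sub>R a i \<in> K"
        using i by (simp add: K_def convex_cone_hull_mul hull_inc)
      from d(2)[OF this] have "\<beta> < t * (a i \<bullet> d)" by (simp add: inner_commute)
      also have "\<dots> = - \<bar>\<beta>\<bar>" using neg by (simp add: t_def)
      finally show False by linarith
    qed
    ultimately show False using b[of d] by (simp add: inner_commute)
  qed
  moreover have "K \<subseteq> ?L"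
    unfolding K_def
  proof (rule hull_minimal)
    show "a ` I \<subseteq> ?L"
    proof clarsimp
      fix i assume "i \<in> I"
      then have "a i = (\<Sum>j\<in>I. (if j = i then 1 else 0) *\<^sub>R a j)"
        using I by (simp add: if_distrib[of "\<lambda>r. r *\<^sub>R _"] cong: if_cong)
      then show "\<exists>l. (\<forall>i\<in>I. 0 \<le> l i) \<and> a i = (\<Sum>j\<in>I. l j *\<^sub>R a j)"
        by (intro exI[of _ "\<lambda>j. if j = i then 1 else 0"]) simp
    qed
    show "convex_cone ?L"
      unfolding convex_cone_iff
    proof (intro conjI ballI allI impI)
      show "0 \<in> ?L"
        by (auto intro!: exI[of _ "\<lambda>_. 0"])
    next
      fix y z assume "y \<in> ?L"
        "z \<in> ?L"
      then obtain l m where "\<forall>i\<in>I. 0 \<le> l i" "y = (\<Sum>i\<in>I. l i *\<^sub>R a i)"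
        "\<forall>i\<in>I. 0 \<le> m i" "z = (\<Sum>i\<in>I. m i *\<^sub>R a i)" by blast
      then show "y + z \<in> ?L"
        by (auto intro!: exI[of _ "\<lambda>i. l i + m i"] simp: scaleR_add_left sum.distrib)
    next
      fix y and r :: real
      assume "y \<in> ?L" "0 \<le> r"
      then obtain l where "\<forall>i\<in>I. 0 \<le> l i" "y = (\<Sum>i\<in>I. l i *\<^sub>R a i)" by blast
      with \<open>0 \<le> r\<close> show "r *\<^sub>R y \<in> ?L"
        by (auto intro!: exI[of _ "\<lambda>i. r * l i"] simp: scaleR_sum_right)
    qed
  qed
  ultimately show ?thesis by blast
qed

lemma small_step_nonneg:
  fixes \<alpha> \<beta> :: "'i \<Rightarrow> real"
  assumes "finite I" "\<And>i. i \<in> I \<Longrightarrow> 0 \<le> \<alpha> i"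
    and "\<And>i. i \<in> I \<Longrightarrow> \<alpha> i = 0 \<Longrightarrow> 0 \<le> \<beta> i"
  shows "\<exists>s>0. \<forall>i\<in>I. 0 \<le> \<alpha> i + s * \<beta> i"
proof -
  have "\<forall>\<^sub>F s in at_right 0. 0 \<le> \<alpha> i + s * \<beta> i" if i: "i \<in> I" for i
  proof (cases "\<alpha> i = 0")
    case True
    with assms(3)[OF i] show ?thesis
      by (auto simp: eventually_at_right_field intro!: exI[of _ 1])
  next
    case False
    have "((\<lambda>s. \<alpha> i + s * \<beta> i) \<longlongrightarrow> \<alpha> i + 0 * \<beta> i) (at_right 0)"
      by (intro tendsto_intros)
    moreover have "0 < \<alpha> i + 0 * \<beta> i" using False assms(2)[OF i] by simp
    ultimately have "\<forall>\<^sub>F s in at_right 0. 0 < \<alpha> i + s * \<beta> i" by (rule order_tendstoD(1))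
    then show ?thesis by (rule eventually_mono) simp
  qed
  then have "\<forall>\<^sub>F s in at_right 0. \<forall>i\<in>I. 0 \<le> \<alpha> i + s * \<beta> i"
    using assms(1) by (simp add: eventually_ball_finite)
  moreover have "\<forall>\<^sub>F s in at_right (0::real). 0 < s"
    by (rule eventually_at_right_less)
  ultimately have "\<forall>\<^sub>F s in at_right 0. 0 < s \<and> (\<forall>i\<in>I. 0 \<le> \<alpha> i + s * \<beta> i)"
    by eventually_elim simp
  then show ?thesis
    using eventually_happens'[of "at_right (0::real)"] by force
qed

lemma closed_convex_polyhedral_section:
  fixes G :: "'i \<Rightarrow> 'a::euclidean_space"
  assumes "subspace S"
  shows "closed {w. (\<forall>i\<in>I. 0 \<le> G i \<bullet> w) \<and> w - v \<in> S}"
    and "convex {w. (\<forall>i\<in>I. 0 \<le> G i \<bullet> w) \<and> w - v \<in> S}"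
proof -
  have *: "{w. (\<forall>i\<in>I. 0 \<le> G i \<bullet> w) \<and> w - v \<in> S} = (\<Inter>i\<in>I. {w. G i \<bullet> w \<ge> 0}) \<inter> (+) v ` S"
    by (auto simp: image_iff intro!: bexI[of _ "_ - v"])
  show "closed {w. (\<forall>i\<in>I. 0 \<le> G i \<bullet> w) \<and> w - v \<in> S}"
    unfolding * using assms
    by (intro closed_Int closed_INT ballI closed_halfspace_ge closed_translation closed_subspace)
  show "convex {w. (\<forall>i\<in>I. 0 \<le> G i \<bullet> w) \<and> w - v \<in> S}"
    unfolding * using assms
    by (intro convex_Int convex_INT convex_halfspace_ge convex_translation subspace_imp_convex)
qed

text \<open>The hypotheses on \<open>P\<close> say that it is the orthogonal projector onto \<open>S\<close>. For necessity, the
  Farkas lemma is applied to the projected normals \<open>P (G i)\<close> of the constraints active at \<open>w\<close>.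
  Closedness of their cone requires no independence.\<close>

lemma closest_point_polyhedral_section_iff:
  fixes G :: "'i \<Rightarrow> 'a::euclidean_space" and v w :: 'a
  assumes I: "finite I" and S: "subspace S"
    and P: "linear P" "\<And>y. P y \<in> S" "\<And>s. s \<in> S \<Longrightarrow> P s = s" "\<And>y z. P y \<bullet> z = y \<bullet> P z"
  defines "F \<equiv> {w. (\<forall>i\<in>I. 0 \<le> G i \<bullet> w) \<and> w - v \<in> S}"
  shows "w \<in> F \<and> (\<forall>y\<in>F. dist v w \<le> dist v y) \<longleftrightarrow>
    (\<forall>i\<in>I. 0 \<le> G i \<bullet> w) \<and>
    (\<exists>l. (\<forall>i\<in>I. 0 \<le> l i \<and> l i * (G i \<bullet> w) = 0) \<and> w = v + P (\<Sum>i\<in>I. l i *\<^sub>R G i))"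
    (is "?min \<longleftrightarrow> ?kkt")
proof
  assume min: ?min
  define J where "J = {i\<in>I. G i \<bullet> w = 0}"
  have J: "finite J" "J \<subseteq> I" using I by (auto simp: J_def)
  have "\<exists>l. (\<forall>i\<in>J. 0 \<le> l i) \<and> w - v = (\<Sum>i\<in>J. l i *\<^sub>R P (G i))"
  proof (rule Farkas[OF J(1)])
    fix d assume d: "\<And>i. i \<in> J \<Longrightarrow> 0 \<le> P (G i) \<bullet> d"
    \<comment> \<open>A short step from \<open>w\<close> along \<open>P d\<close> remains admissible, so it cannot bring \<open>w\<close> closer
      to \<open>v\<close>.\<close>
    have "\<exists>s>0. \<forall>i\<in>I. 0 \<le> G i \<bullet> w + s * (G i \<bullet> P d)"
      using min d by (intro small_step_nonneg I) (auto simp: F_def J_def P(4))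
    then obtain s where s: "s > 0" "\<And>i. i \<in> I \<Longrightarrow> 0 \<le> G i \<bullet> w + s * (G i \<bullet> P d)" by blast
    have wS: "w - v \<in> S" using min by (simp add: F_def)
    have "(w - v) + s *\<^sub>R P d \<in> S" by (intro subspace_add subspace_scale S wS P(2))
    then have "w + s *\<^sub>R P d \<in> F"
      using s(2) by (simp add: F_def inner_add_right algebra_simps)
    then have "(v - w) \<bullet> (w + s *\<^sub>R P d - w) \<le> 0"
      using min closed_convex_polyhedral_section[OF S, of I G v, folded F_def]
      by (intro any_closest_point_dot[of F]) auto
    then have "s * ((v - w) \<bullet> P d) \<le> 0" by simp
    then have "0 \<le> (w - v) \<bullet> P d" using s(1) by (simp add: mult_le_0_iff inner_diff_left)
    also have "(w - v) \<bullet> P d = (w - v) \<bullet> d" using P(4)[of "w - v" d] P(3)[OF wS] by simp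
    finally show "0 \<le> (w - v) \<bullet> d" .
  qed
  then obtain l where l: "\<forall>i\<in>J. 0 \<le> l i" "w - v = (\<Sum>i\<in>J. l i *\<^sub>R P (G i))" by blast
  define m where "m i = (if i \<in> J then l i else 0)" for i
  have "(\<Sum>i\<in>I. m i *\<^sub>R G i) = (\<Sum>i\<in>J. l i *\<^sub>R G i)"
    using J I by (intro sum.mono_neutral_cong_right) (auto simp: m_def)
  then have "P (\<Sum>i\<in>I. m i *\<^sub>R G i) = w - v"
    using l(2) by (simp add: linear_sum[OF P(1)] linear_scale[OF P(1)])
  then have "w = v + P (\<Sum>i\<in>I. m i *\<^sub>R G i)" by simp
  moreover have "\<forall>i\<in>I. 0 \<le> m i \<and> m i * (G i \<bullet> w) = 0"
    using l(1) by (auto simp: m_def J_def)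
  ultimately show ?kkt using min by (auto simp: F_def)
next
  assume ?kkt
  then obtain l where w: "\<And>i. i \<in> I \<Longrightarrow> 0 \<le> G i \<bullet> w"
    and l: "\<And>i. i \<in> I \<Longrightarrow> 0 \<le> l i" "\<And>i. i \<in> I \<Longrightarrow> l i * (G i \<bullet> w) = 0"
    and eq: "w = v + P (\<Sum>i\<in>I. l i *\<^sub>R G i)" by blast
  define p where "p = (\<Sum>i\<in>I. l i *\<^sub>R G i)"
  have wv: "w - v = P p" using eq by (simp add: p_def)
  have wS: "w - v \<in> S" by (simp add: wv P(2))
  have "dist v w \<le> dist v y" if y: "y \<in> F" for y
  proof -
    have "(y - v) - (w - v) \<in> S"
      using y wS subspace_diff[OF S] by (simp only: F_def mem_Collect_eq)
    then have yw: "y - w \<in> S" by simp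
    have "p \<bullet> w = 0"
      unfolding p_def inner_sum_left
      by (intro sum.neutral ballI) (simp only: inner_scaleR_left l(2))
    moreover have "(w - v) \<bullet> (y - w) = p \<bullet> (y - w)"
      by (simp only: wv P(4) P(3)[OF yw])
    ultimately have "(w - v) \<bullet> (y - w) = p \<bullet> y"
      by (simp add: inner_diff_right)
    also have "\<dots> = (\<Sum>i\<in>I. l i * (G i \<bullet> y))"
      by (simp add: p_def inner_sum_left)
    also have "\<dots> \<ge> 0"
      using y l(1) by (auto intro!: sum_nonneg mult_nonneg_nonneg simp: F_def)
    finally have "0 \<le> (w - v) \<bullet> (y - w)" .
    moreover have "(norm (y - v))\<^sup>2 = (norm (w - v))\<^sup>2 + 2 * ((w - v) \<bullet> (y - w)) + (norm (y - w))\<^sup>2"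
      by (simp add: power2_norm_eq_inner inner_diff_left inner_diff_right inner_commute algebra_simps)
    ultimately have "(norm (w - v))\<^sup>2 \<le> (norm (y - v))\<^sup>2" by simp
    then show ?thesis by (simp add: dist_norm norm_minus_commute)
  qed
  with w wS show ?min by (auto simp: F_def)
qed

text \<open>Existence and uniqueness of the minimizer make the choice in the extended projection
  immaterial.\<close>

lemma extended_projection_eq_iff:
  fixes v :: "'a::euclidean_space"
  defines "F K S \<equiv> {w. w \<in> K \<and> w - v \<in> S}"
  assumes F: "closed (F K S)" "convex (F K S)" "F K S \<noteq> {}"
  shows "w = extended_projection K S v \<longleftrightarrow> w \<in> F K S \<and> (\<forall>y\<in>F K S. dist v w \<le> dist v y)"
proof -
  define Q where "Q w \<longleftrightarrow> w \<in> F K S \<and> (\<forall>y\<in>F K S. dist v w \<le> dist v y)" for w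
  have "extended_projection K S v = (SOME w. Q w)"
    unfolding extended_projection_def arg_min_on_def arg_min_def is_arg_min_linorder Q_def F_def
    by (simp add: dist_norm norm_minus_commute Ball_def)
  moreover obtain w0 where "w0 \<in> F K S" "\<And>y. y \<in> F K S \<Longrightarrow> dist v w0 \<le> dist v y"
    by (rule distance_attains_inf[OF F(1,3), of v]) (rule that)
  then have "Q w0" by (simp add: Q_def)
  moreover have "w = w'" if "Q w" "Q w'" for w w'
    by (rule any_closest_point_unique[OF F(2,1), where a = v]) (use that in \<open>simp_all add: Q_def\<close>)
  ultimately have "w = extended_projection K S v \<longleftrightarrow> Q w"
    by (metis someI)
  then show ?thesis by (simp add: Q_def)
qed


section \<open>The orthogonal projector of an orthonormal frame\<close>

lemma projector_in_span:
  fixes E :: "real^'k^'n"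
  shows "(E ** transpose E) *v y \<in> span (columns E)"
  by (metis matrix_vector_mul_assoc matrix_vector_mult_in_columnspace)

lemma projector_symmetric:
  fixes E :: "real^'k^'n"
  shows "((E ** transpose E) *v y) \<bullet> z = y \<bullet> ((E ** transpose E) *v z)"
  by (metis dot_lmul_matrix matrix_transpose_mul transpose_transpose vector_transpose_matrix)

lemma projector_fixes_span:
  fixes E :: "real^'k^'n"
  assumes E: "orthonormal_columns E" and "s \<in> span (columns E)"
  shows "(E ** transpose E) *v s = s"
  using assms(2)
proof (induction rule: span_induct)
  case base
  show ?case
    by (auto simp: subspace_def matrix_vector_right_distrib matrix_vector_mult_scaleR)
next
  case (step s)
  then obtain j where s: "s = column j E" by (auto simp: columns_def)
  have "transpose E ** E = mat 1"
    using E by (simp add: matrix_mult_transpose_dot_column orthonormal_columns_def mat_def vec_eq_iff)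
  moreover have "s = E *v axis j 1" by (simp add: s matrix_vector_mult_basis)
  ultimately show ?case
    by (metis matrix_mul_rid matrix_vector_mul_assoc)
qed


section \<open>The equations at a fixed time\<close>

lemma complementary_component:
  assumes "complementary a b"
  shows "a $ i * b $ i = 0"
proof -
  have "\<forall>i\<in>UNIV. a $ i * b $ i = 0"
    using assms unfolding complementary_def inner_vec_def
    by (subst sum_nonneg_eq_0_iff[symmetric]) (auto simp: less_eq_vec_def)
  then show ?thesis by simp
qed

text \<open>Optimality conditions for the velocity of the projected system. Besides the relations of the
  complementarity system they contain tangency of \<open>w\<close> and complementarity of \<open>l\<close> with the
  first-order growth of the constraints along \<open>w\<close>.\<close>

lemma extended_projection_tangent_cone_iff:
  fixes c :: "real^'n \<Rightarrow> real^'c" and E :: "real^'k^'n"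
  assumes c: "continuously_differentiable c" and E: "orthonormal_columns E"
    and x: "x \<in> feasible_set c" and L: "LICQ c x"
    and ne: "tangent_cone (feasible_set c) x \<inter> (+) v ` span (columns E) \<noteq> {}"
  shows "w = extended_projection (tangent_cone (feasible_set c) x) (span (columns E)) v \<longleftrightarrow>
    (\<forall>i\<in>active_set c x. 0 \<le> cgrad c x i \<bullet> w) \<and>
    (\<exists>l. complementary l (c x) \<and> (\<forall>i. l $ i * (cgrad c x i \<bullet> w) = 0) \<and>
         w = v + (E ** transpose E ** gradient_matrix c x) *v l)"
    (is "_ \<longleftrightarrow> ?feas \<and> (\<exists>l. ?M l)")
proof -
  let ?A = "active_set c x" and ?S = "span (columns E)" and ?P = "\<lambda>y. (E ** transpose E) *v y"
  let ?F = "{w. (\<forall>i\<in>?A. 0 \<le> cgrad c x i \<bullet> w) \<and> w - v \<in> ?S}"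
  have T: "{w. w \<in> tangent_cone (feasible_set c) x \<and> w - v \<in> ?S} = ?F"
    by (simp add: tangent_cone_LICQ[OF c x L])
  obtain s where "s \<in> ?S" "v + s \<in> tangent_cone (feasible_set c) x"
    using ne by blast
  then have "v + s \<in> {w. w \<in> tangent_cone (feasible_set c) x \<and> w - v \<in> ?S}" by simp
  then have Fne: "?F \<noteq> {}" unfolding T by blast
  have "w = extended_projection (tangent_cone (feasible_set c) x) ?S v \<longleftrightarrow>
      w \<in> ?F \<and> (\<forall>y\<in>?F. dist v w \<le> dist v y)"
    using extended_projection_eq_iff[where K = "tangent_cone (feasible_set c) x" and S = ?S and v = v,
        unfolded T, OF closed_convex_polyhedral_section[OF subspace_span] Fne] .
  also have "\<dots> \<longleftrightarrow> ?feas \<and> (\<exists>l. (\<forall>i\<in>?A. 0 \<le> l i \<and> l i * (cgrad c x i \<bullet> w) = 0) \<and>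
      w = v + ?P (\<Sum>i\<in>?A. l i *\<^sub>R cgrad c x i))"
    by (intro closest_point_polyhedral_section_iff)
      (auto simp: projector_in_span projector_symmetric projector_fixes_span[OF E])
  also have "(\<exists>l. (\<forall>i\<in>?A. 0 \<le> l i \<and> l i * (cgrad c x i \<bullet> w) = 0) \<and>
      w = v + ?P (\<Sum>i\<in>?A. l i *\<^sub>R cgrad c x i)) \<longleftrightarrow> (\<exists>l. ?M l)" (is "?lhs \<longleftrightarrow> ?rhs")
  proof
    assume ?lhs
    then obtain l where l: "\<And>i. i \<in> ?A \<Longrightarrow> 0 \<le> l i" "\<And>i. i \<in> ?A \<Longrightarrow> l i * (cgrad c x i \<bullet> w) = 0"
      and w: "w = v + ?P (\<Sum>i\<in>?A. l i *\<^sub>R cgrad c x i)" by blast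
    \<comment> \<open>Multipliers of inactive constraints are zero, as complementarity with \<open>c x\<close> demands.\<close>
    define m :: "real^'c" where "m = (\<chi> i. if i \<in> ?A then l i else 0)"
    have "complementary m (c x)"
      using x l(1) unfolding complementary_def
      by (auto simp: feasible_set_def m_def less_eq_vec_def inner_vec_def active_set_def
          intro!: sum.neutral)
    moreover have "\<forall>i. m $ i * (cgrad c x i \<bullet> w) = 0"
      using l(2) by (auto simp: m_def)
    moreover have "(\<Sum>i\<in>UNIV. m $ i *\<^sub>R cgrad c x i) = (\<Sum>i\<in>?A. l i *\<^sub>R cgrad c x i)"
      by (rule sum.mono_neutral_cong_right) (auto simp: m_def)
    then have "w = v + (E ** transpose E ** gradient_matrix c x) *v m"
      using w by (simp add: matrix_vector_mul_assoc[symmetric] gradient_matrix_mult)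
    ultimately show ?rhs by blast
  next
    assume ?rhs
    then obtain l where l: "complementary l (c x)" "\<forall>i. l $ i * (cgrad c x i \<bullet> w) = 0"
      and w: "w = v + (E ** transpose E ** gradient_matrix c x) *v l" by blast
    have "l $ i = 0" if "i \<notin> ?A" for i
      using that complementary_component[OF l(1), of i] by (simp add: active_set_def)
    then have "(\<Sum>i\<in>UNIV. l $ i *\<^sub>R cgrad c x i) = (\<Sum>i\<in>?A. l $ i *\<^sub>R cgrad c x i)"
      by (intro sum.mono_neutral_right) auto
    then have "w = v + ?P (\<Sum>i\<in>?A. l $ i *\<^sub>R cgrad c x i)"
      using w by (simp add: matrix_vector_mul_assoc[symmetric] gradient_matrix_mult)
    moreover have "\<forall>i\<in>?A. 0 \<le> l $ i \<and> l $ i * (cgrad c x i \<bullet> w) = 0"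
      using l by (auto simp: complementary_def less_eq_vec_def)
    ultimately show ?lhs by (intro exI[of _ "\<lambda>i. l $ i"]) blast
  qed
  finally show ?thesis .
qed


section \<open>Trajectories\<close>

lemma absolutely_continuous_fun_on_imp_continuous_on:
  fixes x :: "real \<Rightarrow> 'a::real_normed_vector"
  assumes "is_interval I" and x: "absolutely_continuous_fun_on I x"
  shows "continuous_on I x"
  unfolding continuous_on_iff
proof (intro ballI allI impI)
  fix s and e :: real assume s: "s \<in> I" and "0 < e"
  then obtain r where "r > 0" and r: "\<And>D. finite D \<Longrightarrow> (\<forall>(a, b)\<in>D. a < b \<and> {a..b} \<subseteq> I) \<Longrightarrow>
        pairwise (\<lambda>(a, b) (a', b'). {a<..<b} \<inter> {a'<..<b'} = {}) D \<Longrightarrow>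
        (\<Sum>(a, b)\<in>D. b - a) < r \<Longrightarrow> (\<Sum>(a, b)\<in>D. norm (x b - x a)) < e"
    using x unfolding absolutely_continuous_fun_on_def by meson
  have step: "norm (x b - x a) < e" if "a < b" "a \<in> I" "b \<in> I" "b - a < r" for a b
  proof -
    have "{a..b} \<subseteq> I"
      using that(2,3) mem_is_interval_1_I[OF assms(1)] by (meson atLeastAtMost_iff subsetI)
    then show ?thesis using r[of "{(a, b)}"] that by simp
  qed
  have "dist (x s') (x s) < e" if "s' \<in> I" "dist s' s < r" for s'
    using step[of s s'] step[of s' s] that s \<open>0 < e\<close>
    by (cases s s' rule: linorder_cases) (auto simp: dist_norm norm_minus_commute)
  then show "\<exists>d>0. \<forall>s'\<in>I. dist s' s < d \<longrightarrow> dist (x s') (x s) < e"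
    using \<open>r > 0\<close> by blast
qed

lemma AE_lebesgue_on_closed_imp_all:
  fixes a b :: real
  assumes "a < b" and F: "closed F" and ae: "AE t in lebesgue_on {a..b}. t \<in> F"
  shows "{a..b} \<subseteq> F"
proof -
  have "AE t in lebesgue. t \<in> {a..b} \<longrightarrow> t \<in> F"
    using ae by (subst (asm) AE_restrict_space_iff) auto
  then obtain N where N: "N \<in> null_sets lebesgue" "{t \<in> space lebesgue. \<not> (t \<in> {a..b} \<longrightarrow> t \<in> F)} \<subseteq> N"
    unfolding eventually_ae_filter by blast
  have "negligible ({a<..<b} - F)"
  proof (rule negligible_subset)
    show "negligible N" using N(1) by (simp add: negligible_iff_null_sets)
    show "{a<..<b} - F \<subseteq> N" using N(2) by auto
  qed
  moreover have "open ({a<..<b} - F)" using F by (simp add: open_Diff)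
  ultimately have "{a<..<b} - F = {}" using open_not_negligible by blast
  then have "closure {a<..<b} \<subseteq> F" using F by (intro closure_minimal) auto
  then show ?thesis using \<open>a < b\<close> by simp
qed

text \<open>An active constraint function attains a minimum along the feasible trajectory, so its
  derivative vanishes. The time must be interior: at the left endpoint the velocity may point into
  the feasible set.\<close>

lemma feasible_velocity_orthogonal:
  fixes x :: "real \<Rightarrow> real^'n"
  assumes c: "continuously_differentiable c"
    and feas: "\<And>s. s \<in> {a..b} \<Longrightarrow> x s \<in> feasible_set c"
    and t: "a < t" "t < b" and D: "(x has_vector_derivative w) (at t within {a..b})"
    and i: "i \<in> active_set c (x t)"
  shows "cgrad c (x t) i \<bullet> w = 0"
proof -
  have "(x has_derivative (\<lambda>h. h *\<^sub>R w)) (at t)"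
    using D t by (simp add: has_vector_derivative_def at_within_Icc_at)
  from has_derivative_compose[OF this has_derivative_cgrad[OF c]]
  have "((\<lambda>s. c (x s) $ i) has_derivative (\<lambda>h. cgrad c (x t) i \<bullet> (h *\<^sub>R w))) (at t)" .
  then have "((\<lambda>s. c (x s) $ i) has_real_derivative (cgrad c (x t) i \<bullet> w)) (at t)"
    by (simp add: has_field_derivative_def mult.commute[of _ "cgrad c (x t) i \<bullet> w"])
  moreover have "\<forall>s. \<bar>t - s\<bar> < min (t - a) (b - t) \<longrightarrow> c (x t) $ i \<le> c (x s) $ i"
  proof (intro allI impI)
    fix s assume "\<bar>t - s\<bar> < min (t - a) (b - t)"
    then have "s \<in> {a..b}" by auto
    from feas[OF this] i show "c (x t) $ i \<le> c (x s) $ i"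
      by (simp add: feasible_set_def less_eq_vec_def active_set_def)
  qed
  ultimately show ?thesis
    using t by (intro DERIV_local_min[of _ _ t "min (t - a) (b - t)"]) auto
qed

lemma continuously_differentiable_imp_continuous_on:
  "continuously_differentiable c \<Longrightarrow> continuous_on S c"
  unfolding continuously_differentiable_def
  by (meson has_derivative_continuous continuous_at_imp_continuous_on)

theorem theorem2:
  fixes c :: "real^'n \<Rightarrow> real^'c"
    and f :: "(real^'n) \<times> (real^'m) \<Rightarrow> real^'n"
    and u :: "real \<Rightarrow> real^'m"
    and E :: "real^'k^'n"
    and x :: "real \<Rightarrow> real^'n"
    and T :: real
  assumes "0 \<le> T"
    and "continuously_differentiable c"
    and "f differentiable_on UNIV"
    and "CARD('k) \<le> CARD('n)"
    and "orthonormal_columns E"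
    and "absolutely_continuous_fun_on {0..T} x"
    and "x 0 \<in> feasible_set c"
    and "\<And>t. t \<in> {0..T} \<Longrightarrow> x t \<in> feasible_set c \<Longrightarrow> LICQ c (x t)"
    and "\<And>t. t \<in> {0..T} \<Longrightarrow> x t \<in> feasible_set c \<Longrightarrow>
           tangent_cone (feasible_set c) (x t) \<inter> (+) (f (x t, u t)) ` span (columns E) \<noteq> {}"
  shows "ePDS_solution T (feasible_set c) (span (columns E)) f u x \<longleftrightarrow> DCS_solution T c E f u x"
proof -
  note T = assms(1) and c = assms(2) and E = assms(5) and ac = assms(6)
    and x0 = assms(7) and licq = assms(8) and ne = assms(9)
  let ?C = "feasible_set c" and ?S = "span (columns E)"
  let ?proj = "\<lambda>t. extended_projection (tangent_cone ?C (x t)) ?S (f (x t, u t))"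
  let ?rhs = "\<lambda>t l. f (x t, u t) + (E ** transpose E ** gradient_matrix c (x t)) *v l"
  have space: "AE t in lebesgue_on {0..T}. t \<in> {0..T}"
    using AE_space[of "lebesgue_on {0..T}"] by simp
  note proj_iff = extended_projection_tangent_cone_iff[OF c E _ licq ne]
  show ?thesis
  proof
    assume "ePDS_solution T ?C ?S f u x"
    then have feas: "\<And>t. t \<in> {0..T} \<Longrightarrow> x t \<in> ?C"
      and ode: "AE t in lebesgue_on {0..T}. (x has_vector_derivative ?proj t) (at t within {0..T})"
      by (auto simp: ePDS_solution_def)
    have "\<exists>l. complementary l (c (x t)) \<and> ?proj t = ?rhs t l" if "t \<in> {0..T}" for t
      using iffD1[OF proj_iff[OF feas[OF that] that feas[OF that] that feas[OF that]] refl] by blast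
    then obtain l where l: "\<And>t. t \<in> {0..T} \<Longrightarrow> complementary (l t) (c (x t)) \<and> ?proj t = ?rhs t (l t)"
      by metis
    from ode space have "AE t in lebesgue_on {0..T}.
        (x has_vector_derivative ?rhs t (l t)) (at t within {0..T}) \<and> complementary (l t) (c (x t))"
      by eventually_elim (metis l)
    with ac show "DCS_solution T c E f u x"
      unfolding DCS_solution_def by blast
  next
    assume "DCS_solution T c E f u x"
    then obtain l where ode: "AE t in lebesgue_on {0..T}.
        (x has_vector_derivative ?rhs t (l t)) (at t within {0..T}) \<and> complementary (l t) (c (x t))"
      unfolding DCS_solution_def by blast
    have cont: "continuous_on {0..T} (\<lambda>t. c (x t))"
      using ac c
      by (intro continuous_on_compose2[OF continuously_differentiable_imp_continuous_on[of c UNIV]]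
          absolutely_continuous_fun_on_imp_continuous_on) (auto simp: is_interval_1)
    have feas: "x t \<in> ?C" if t: "t \<in> {0..T}" for t
      \<comment> \<open>For \<open>T = 0\<close> the complementarity system holds vacuously almost everywhere, and only the
        initial condition gives feasibility.\<close>
    proof (cases "T = 0")
      case True
      with t x0 show ?thesis by simp
    next
      case False
      define F where "F = {t \<in> {0..T}. \<forall>i. 0 \<le> c (x t) $ i}"
      have "F = {0..T} \<inter> (\<lambda>t. c (x t)) -` {y. \<forall>i. 0 \<le> y $ i}" by (auto simp: F_def)
      moreover have "closed {y :: real^'c. \<forall>i. 0 \<le> y $ i}"
        by (intro closed_Collect_all closed_Collect_le continuous_intros)
      ultimately have "closed F"
        by (simp only: continuous_closed_preimage[OF cont closed_real_atLeastAtMost])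
      moreover from ode space have "AE t in lebesgue_on {0..T}. t \<in> F"
        by eventually_elim (auto simp: F_def complementary_def less_eq_vec_def)
      ultimately have "{0..T} \<subseteq> F"
        using T False by (intro AE_lebesgue_on_closed_imp_all) auto
      then show ?thesis
        using t by (auto simp: F_def feasible_set_def less_eq_vec_def)
    qed
    have "AE t in lebesgue. t \<notin> {0, T}"
      by (rule AE_not_in) (simp add: negligible_iff_null_sets[symmetric])
    then have "AE t in lebesgue. t \<in> {0..T} \<longrightarrow> t \<notin> {0, T}"
      by (rule eventually_mono) simp
    then have endpoints: "AE t in lebesgue_on {0..T}. t \<notin> {0, T}"
      by (subst AE_restrict_space_iff) simp_all
    from ode space endpoints have "AE t in lebesgue_on {0..T}.
        (x has_vector_derivative ?proj t) (at t within {0..T})"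
    proof eventually_elim
      case (elim t)
      then have t: "0 < t" "t < T" and tT: "t \<in> {0..T}"
        and D: "(x has_vector_derivative ?rhs t (l t)) (at t within {0..T})"
        and compl: "complementary (l t) (c (x t))" by auto
      have orth: "cgrad c (x t) i \<bullet> ?rhs t (l t) = 0" if "i \<in> active_set c (x t)" for i
        by (rule feasible_velocity_orthogonal[OF c _ t D that]) (rule feas)
      have "l t $ i * (cgrad c (x t) i \<bullet> ?rhs t (l t)) = 0" for i
        using orth[of i] complementary_component[OF compl, of i]
        by (cases "i \<in> active_set c (x t)") (auto simp: active_set_def)
      then have "?rhs t (l t) = ?proj t"
        using orth compl
        by (intro iffD2[OF proj_iff[OF feas[OF tT] tT feas[OF tT] tT feas[OF tT]]]) auto
      with D show ?case by simp
    qed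
    with ac x0 feas show "ePDS_solution T ?C ?S f u x"
      by (simp add: ePDS_solution_def)
  qed
qed

end
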